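(* Let $A \in \mathbb{C}^{m \times n}$ and $W \in \mathbb{C}^{n \times m}$. Then the set $A\{1',2',3'\}$ is nonempty if and only if $r(WAW)=r(A)$.
   Context: $r(\cdot)$ denotes rank and $*$ conjugate transpose. For $A \in \mathbb{C}^{m \times n}$, $W \in \mathbb{C}^{n \times m}$, the set $A\{1',2',3'\}$ (depending on $W$) consists of all $X \in \mathbb{C}^{m \times n}$ such that $(1')$ $AWXWA=A$, $(2')$ $XWAWX=X$, and $(3')$ $(WAWX)^*=WAWX$. *)

theory Defs
  imports "HOL-Analysis.Analysis"
begin

definition conj_transpose :: "complex ^ 'n ^ 'm \<Rightarrow> complex ^ 'm ^ 'n"
  where "conj_transpose A = (\<chi> i j. cnj (A $ j $ i))"

text \<open>A matrix in $\mathbb{C}^{m \times n}$ has type \<open>complex ^ 'n ^ 'm\<close> (the row index type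
  comes last). The three conjuncts are the conditions $(1')$, $(2')$, $(3')$.\<close>

definition weighted_inverses_123 ::
    "complex ^ 'n ^ 'm \<Rightarrow> complex ^ 'm ^ 'n \<Rightarrow> (complex ^ 'n ^ 'm) set"
  where "weighted_inverses_123 A W =
    {X. A ** W ** X ** W ** A = A \<and>
        X ** W ** A ** W ** X = X \<and>
        conj_transpose (W ** A ** W ** X) = W ** A ** W ** X}"

end

theory Submission
  imports Defs
begin

text \<open>If \<open>r(WAW) = r(A)\<close>, then \<open>AW\<close> and \<open>WAW\<close> have the same row space and \<open>A\<close> and \<open>AW\<close> the same
  column space, so that \<open>AW = L(WAW)\<close> and \<open>A = (AW)R\<close>. With \<open>B = WAW\<close> and \<open>X\<close> a \<open>{1,2,3}\<close>-inverse
  of \<open>B\<close>, these factorizations cancel the outer factors in \<open>BXB = B\<close> and give \<open>AWXWA = A\<close>.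
  Conversely, \<open>(1')\<close> and \<open>(2')\<close> yield \<open>A = (AWX)(WAW)(XWA)\<close>.\<close>

subsection \<open>Rank over a field\<close>

lemma row_matrix_mult: "row i (A ** B) = transpose B *v row i A"
  for A :: "'a::comm_semiring_1^'n^'m" and B :: "'a^'p^'n"
  by (simp add: vec_eq_iff row_def matrix_matrix_mult_def matrix_vector_mult_def transpose_def mult.commute)

lemma row_matrix_mult_sum: "row i (A ** B) = (\<Sum>k\<in>UNIV. A $ i $ k *s row k B)"
  for A :: "'a::comm_semiring_1^'n^'m" and B :: "'a^'p^'n"
  by (simp add: vec_eq_iff row_def matrix_matrix_mult_def)

lemma rows_matrix_mult_subset_span: "rows (A ** B) \<subseteq> vec.span (rows B)"
  for A :: "'a::field^'n^'m" and B :: "'a^'p^'n"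
proof -
  have "row k B \<in> vec.span (rows B)" for k
    by (rule vec.span_base) (auto simp: rows_def)
  then show ?thesis
    by (auto simp: rows_def[of "A ** B"] row_matrix_mult_sum intro: vec.span_sum vec.span_scale)
qed

lemma rank_mul_le_right_field: "rank (A ** B) \<le> rank B"
  for A :: "'a::field^'n^'m" and B :: "'a^'p^'n"
  unfolding row_rank_def_gen
  using vec.dim_le_card vec.dim_mono[OF rows_matrix_mult_subset_span] by blast

text \<open>Expand every row in a basis \<open>S\<close> of the row space. Reading these expansions
  entrywise makes each column a combination of the \<open>card S\<close> coefficient vectors, one
  for each basis row.\<close>

lemma dim_columns_le_rank: "vec.dim (columns A) \<le> rank A"
  for A :: "'a::field^'n^'m"
proof -
  obtain S where S: "S \<subseteq> rows A" "vec.independent S" "rows A \<subseteq> vec.span S" "card S = vec.dim (rows A)"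
    using vec.basis_exists by blast
  have fin: "finite S"
    using S(2) vec.finiteI_independent by blast
  have "\<exists>c. row i A = (\<Sum>s\<in>S. c s *s s)" for i
  proof -
    have "row i A \<in> vec.span S"
      using S(3) by (auto simp: rows_def)
    then show ?thesis
      by (auto simp: vec.span_finite[OF fin])
  qed
  then obtain c where c: "\<And>i. row i A = (\<Sum>s\<in>S. c i s *s s)"
    by metis
  have "column j A = (\<Sum>s\<in>S. (s $ j) *s (\<chi> i. c i s))" for j
  proof -
    have "A $ i $ j = (\<Sum>s\<in>S. c i s * s $ j)" for i
      using arg_cong[OF c[of i], of "\<lambda>v. v $ j"] by (simp add: row_def)
    then show ?thesis
      by (simp add: vec_eq_iff column_def mult.commute)
  qed
  then have "columns A \<subseteq> vec.span ((\<lambda>s. \<chi> i. c i s) ` S)"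
    by (auto simp: columns_def intro: vec.span_sum vec.span_scale vec.span_base)
  then have "vec.dim (columns A) \<le> card ((\<lambda>s. \<chi> i. c i s) ` S)"
    using fin by (intro vec.dim_le_card) auto
  also have "\<dots> \<le> card S"
    using fin by (rule card_image_le)
  finally show ?thesis
    using S(4) by (simp add: row_rank_def_gen)
qed

lemma rank_transpose_field: "rank (transpose A) = rank A"
  for A :: "'a::field^'n^'m"
proof -
  have le: "rank (transpose B) \<le> rank B" for B :: "'a^'k^'l"
    using dim_columns_le_rank[of B] by (simp add: row_rank_def_gen rows_transpose)
  show ?thesis
    using le[of A] le[of "transpose A"] by (simp add: transpose_transpose)
qed

lemma rank_mul_le_left_field: "rank (A ** B) \<le> rank A"
  for A :: "'a::field^'n^'m" and B :: "'a^'p^'n"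
  by (metis matrix_transpose_mul rank_mul_le_right_field rank_transpose_field)

text \<open>The row space of \<open>B\<close> is the range of \<open>transpose B\<close>, so each
  row of \<open>A\<close> has a coefficient vector; stacked as rows, these vectors form
  \<open>L\<close>.\<close>

lemma rows_subset_span_imp_factor:
  fixes A :: "'a::field^'n^'m" and B :: "'a^'n^'p"
  assumes "rows A \<subseteq> vec.span (rows B)"
  obtains L where "A = L ** B"
proof -
  have "\<exists>v. row i A = transpose B *v v" for i
  proof -
    have "vec.span (rows B) \<subseteq> range ((*v) (transpose B))"
    proof (rule vec.span_minimal)
      have "row k B = transpose B *v axis k 1" for k
        by (simp add: vec_eq_iff row_def matrix_vector_mult_def transpose_def axis_def if_distrib cong: if_cong)
      then show "rows B \<subseteq> range ((*v) (transpose B))"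
        by (auto simp: rows_def)
      show "vec.subspace (range ((*v) (transpose B)))"
        by (metis matrix_vector_mul_linear_gen vec.linear_subspace_image vec.subspace_UNIV)
    qed
    then show ?thesis
      using assms by (force simp: rows_def)
  qed
  then obtain v where v: "\<And>i. row i A = transpose B *v v i"
    by metis
  have "row i (\<chi> i. v i) = v i" for i
    by (simp add: row_def)
  then have "row i A = row i ((\<chi> i. v i) ** B)" for i
    by (simp add: row_matrix_mult v)
  then have "A = (\<chi> i. v i) ** B"
    by (simp add: row_def vec_eq_iff)
  then show thesis ..
qed

text \<open>The row space of \<open>A ** B\<close> lies in that of \<open>B\<close>; equal
  dimensions force equality, so the rows of \<open>B\<close> can be recovered from those of the
  product.\<close>

lemma rank_mul_eq_right_imp_factor:
  fixes A :: "'a::field^'n^'m" and B :: "'a^'p^'n"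
  assumes "rank (A ** B) = rank B"
  obtains L where "B = L ** (A ** B)"
proof -
  have "vec.span (rows (A ** B)) = vec.span (rows B)"
  proof (rule vec.subspace_dim_equal)
    show "vec.span (rows (A ** B)) \<subseteq> vec.span (rows B)"
      by (simp add: vec.span_minimal rows_matrix_mult_subset_span)
  qed (use assms in \<open>auto simp: row_rank_def_gen\<close>)
  then have "rows B \<subseteq> vec.span (rows (A ** B))"
    by (simp add: vec.span_superset)
  then show thesis
    using that by (rule rows_subset_span_imp_factor)
qed

lemma rank_mul_eq_left_imp_factor:
  fixes A :: "'a::field^'n^'m" and B :: "'a^'p^'n"
  assumes "rank (A ** B) = rank A"
  obtains R where "A = A ** B ** R"
proof -
  have "rank (transpose B ** transpose A) = rank (transpose A)"
    using assms by (metis matrix_transpose_mul rank_transpose_field)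
  then obtain L where "transpose A = L ** (transpose B ** transpose A)"
    by (rule rank_mul_eq_right_imp_factor)
  then have "A = A ** B ** transpose L"
    by (metis matrix_transpose_mul transpose_transpose)
  then show thesis ..
qed

subsection \<open>Least-squares inverses\<close>

lemma conj_transpose_conj_transpose: "conj_transpose (conj_transpose A) = A"
  by (simp add: conj_transpose_def vec_eq_iff)

lemma conj_transpose_mult: "conj_transpose (A ** B) = conj_transpose B ** conj_transpose A"
  by (simp add: conj_transpose_def matrix_matrix_mult_def vec_eq_iff mult.commute)

lemma inner_conj_transpose: "(conj_transpose B *v u) \<bullet> z = u \<bullet> (B *v z)"
proof -
  \<comment> \<open>For the real inner product on the complex plane, multiplication by
    \<open>cnj a\<close> is adjoint to multiplication by \<open>a\<close>; the claim sums this over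
    the entries.\<close>
  have swap: "(cnj a * b) \<bullet> c = b \<bullet> (a * c)" for a b c :: complex
    by (simp add: inner_complex_def algebra_simps)
  have "(conj_transpose B *v u) \<bullet> z = (\<Sum>j\<in>UNIV. \<Sum>i\<in>UNIV. (cnj (B $ i $ j) * u $ i) \<bullet> z $ j)"
    by (simp add: inner_vec_def conj_transpose_def matrix_vector_mult_def inner_sum_left)
  also have "\<dots> = (\<Sum>i\<in>UNIV. \<Sum>j\<in>UNIV. (cnj (B $ i $ j) * u $ i) \<bullet> z $ j)"
    by (rule sum.swap)
  also have "\<dots> = u \<bullet> (B *v z)"
    by (simp add: inner_vec_def matrix_vector_mult_def inner_sum_right swap)
  finally show ?thesis .
qed

text \<open>The residual is orthogonal to the range of \<open>B\<close> only for the real inner product of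
  \<open>complex ^ 'n\<close>. That suffices, as the conjugate transpose is also the adjoint for it.\<close>

lemma normal_equation_solvable: "\<exists>x. conj_transpose B *v (B *v x) = conj_transpose B *v v"
proof -
  obtain y z where y: "y \<in> span (range ((*v) B))"
    and z: "\<And>w. w \<in> span (range ((*v) B)) \<Longrightarrow> orthogonal z w" and v: "v = y + z"
    using orthogonal_subspace_decomp_exists by metis
  have "linear ((*v) B)"
    by (rule linearI) (simp_all add: vec_eq_iff matrix_vector_mult_def sum.distrib algebra_simps scaleR_sum_right)
  then have "subspace (range ((*v) B))"
    by (simp add: linear_subspace_image)
  with y obtain x where x: "y = B *v x"
    by (auto simp: span_eq_iff[THEN iffD2])
  \<comment> \<open>Moving one \<open>conj_transpose B\<close> across the inner product pairs
    \<open>z\<close> with a vector in the range of \<open>B\<close>, to which it is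
    orthogonal.\<close>
  have "(conj_transpose B *v z) \<bullet> (conj_transpose B *v z) = 0"
    by (metis inner_conj_transpose orthogonal_def rangeI span_base z)
  then have "conj_transpose B *v z = 0"
    by simp
  then show ?thesis
    unfolding v x by (metis add.right_neutral matrix_vector_right_distrib)
qed

lemma ex_inverse_123:
  fixes B :: "complex ^ 'm ^ 'n"
  obtains X where "B ** X ** B = B" "X ** B ** X = X" "conj_transpose (B ** X) = B ** X"
proof -
  obtain x where x: "\<And>v. conj_transpose B *v (B *v x v) = conj_transpose B *v v"
    using normal_equation_solvable by metis
  \<comment> \<open>The columns of \<open>Y\<close> are least-squares solutions for the standard
    basis vectors, which turns the normal equations into the matrix equation
    \<open>N\<close>.\<close>
  define Y where "Y = (\<chi> i j. x (axis j 1) $ i)"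
  have "column j Y = x (axis j 1)" for j
    by (simp add: Y_def column_def)
  moreover have col: "column j (C ** D) = C *v column j D"
    for j and C :: "complex^'b^'a" and D :: "complex^'c^'b"
    by (simp add: vec_eq_iff column_def matrix_matrix_mult_def matrix_vector_mult_def)
  moreover have "column j (mat 1 :: complex^'n^'n) = axis j 1" for j
    by (simp add: vec_eq_iff column_def mat_def axis_def)
  ultimately have "column j (conj_transpose B ** (B ** Y)) = column j (conj_transpose B ** mat 1)" for j
    by (simp only: col x)
  then have N: "conj_transpose B ** (B ** Y) = conj_transpose B"
    by (simp add: column_def vec_eq_iff)
  have N': "conj_transpose (B ** Y) ** B = B"
    using arg_cong[OF N, of conj_transpose] by (simp add: conj_transpose_mult conj_transpose_conj_transpose)
  \<comment> \<open>The same product equals both \<open>B ** Y\<close> and its conjugate transpose,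
    hence \<open>B ** Y\<close> is Hermitian.\<close>
  have "conj_transpose (B ** Y) ** (B ** Y) = B ** Y"
    by (simp add: N' matrix_mul_assoc)
  moreover have "conj_transpose (B ** Y) ** (B ** Y) = conj_transpose (B ** Y)"
    using N by (metis conj_transpose_mult matrix_mul_assoc)
  ultimately have H: "conj_transpose (B ** Y) = B ** Y"
    by simp
  have BYB: "B ** Y ** B = B"
    using N' H by simp
  show thesis
  proof
    \<comment> \<open>\<open>Y\<close> itself may violate the second equation. Passing to
      \<open>Y ** B ** Y\<close> repairs this and leaves the product with \<open>B\<close> on the
      left unchanged.\<close>
    show "B ** (Y ** B ** Y) ** B = B" "Y ** B ** Y ** B ** (Y ** B ** Y) = Y ** B ** Y"
      "conj_transpose (B ** (Y ** B ** Y)) = B ** (Y ** B ** Y)"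
      using BYB H by (metis matrix_mul_assoc)+
  qed
qed

theorem theorem2p1:
  fixes A :: "complex ^ 'n ^ 'm" and W :: "complex ^ 'm ^ 'n"
  shows "weighted_inverses_123 A W \<noteq> {} \<longleftrightarrow> rank (W ** A ** W) = rank A"
proof
  assume "weighted_inverses_123 A W \<noteq> {}"
  then obtain X where 1: "A ** W ** X ** W ** A = A" and 2: "X ** W ** A ** W ** X = X"
    by (auto simp: weighted_inverses_123_def)
  \<comment> \<open>Replacing the \<open>X\<close> in \<open>1\<close> by the left side of
    \<open>2\<close> creates the inner factor \<open>W ** A ** W\<close>.\<close>
  have "A = A ** W ** (X ** W ** A ** W ** X) ** W ** A"
    by (simp add: 1 2)
  also have "\<dots> = (A ** W ** X) ** (W ** A ** W) ** (X ** W ** A)"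
    by (simp add: matrix_mul_assoc)
  finally have "rank A \<le> rank (W ** A ** W)"
    by (metis rank_mul_le_left_field rank_mul_le_right_field order_trans)
  moreover have "rank (W ** A ** W) \<le> rank A"
    by (metis rank_mul_le_left_field rank_mul_le_right_field order_trans)
  ultimately show "rank (W ** A ** W) = rank A"
    by simp
next
  assume r: "rank (W ** A ** W) = rank A"
  \<comment> \<open>The rank of \<open>A ** W\<close> is squeezed between two equal ranks, so both
    inequalities are equalities and each yields a factorization.\<close>
  have "rank (W ** (A ** W)) \<le> rank (A ** W)" "rank (A ** W) \<le> rank A"
    by (rule rank_mul_le_right_field rank_mul_le_left_field)+
  with r have "rank (W ** (A ** W)) = rank (A ** W)" "rank (A ** W) = rank A"
    by (simp_all add: matrix_mul_assoc)
  then obtain L R where L: "A ** W = L ** (W ** (A ** W))" and R: "A = A ** W ** R"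
    by (metis rank_mul_eq_left_imp_factor rank_mul_eq_right_imp_factor)
  obtain X where X: "(W ** A ** W) ** X ** (W ** A ** W) = W ** A ** W"
      "X ** (W ** A ** W) ** X = X"
      "conj_transpose ((W ** A ** W) ** X) = (W ** A ** W) ** X"
    by (rule ex_inverse_123)
  have "A ** W ** X ** W ** A = (L ** (W ** (A ** W))) ** X ** W ** (A ** W ** R)"
    using L R by simp
  also have "\<dots> = L ** ((W ** A ** W) ** X ** (W ** A ** W)) ** R"
    by (simp add: matrix_mul_assoc)
  also have "\<dots> = (L ** (W ** (A ** W))) ** R"
    by (simp only: X(1)) (simp add: matrix_mul_assoc)
  also have "\<dots> = A"
    using L R by simp
  finally have "X \<in> weighted_inverses_123 A W"
    using X by (simp add: weighted_inverses_123_def matrix_mul_assoc)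
  then show "weighted_inverses_123 A W \<noteq> {}"
    by blast
qed

end
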